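(* Let $(\Omega, B, \mathbf{P})$ be a probability space, let $p \in [0,1]$, and let $A(p) \in B$ be any event with $\mathbf{P}(A(p)) = p$. Let $\eta_p = I(A(p)) - p$, where $I(A(p))$ is the indicator function of $A(p)$. Then $$\|\eta_p\|_{\mathrm{Sub}} = Q(p).$$
   Context: For a centered ($\mathbf{E}\xi = 0$) real random variable $\xi$, the subgaussian norm is $$\|\xi\|_{\mathrm{Sub}} = \inf\{\tau > 0 : \mathbf{E}\exp(\lambda \xi) \le \exp(\lambda^2\tau^2) \text{ for all } \lambda \in \mathbb{R}\}$$ (note that there is no factor $1/2$ in the exponent); equivalently, $\|\xi\|_{\mathrm{Sub}} = \sup_{\lambda \neq 0} \sqrt{\ln \mathbf{E}\exp(\lambda\xi)}/|\lambda|$. The function $Q:[0,1]\to[0,\infty)$ is the non-negative continuous function given by $$Q(p) = \sqrt{\frac{1-2p}{4\ln((1-p)/p)}}$$ for $p \in (0,1)$, $p \ne 1/2$, and extended by continuity to the remaining points: $Q(0) = Q(1) = 0$ and $Q(1/2)^2 = 1/8$. *)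

theory Defs
  imports "HOL-Probability.Probability" "HOL-Real_Asymp.Real_Asymp"
begin

text \<open>
  The norm is meant for centered \<open>\<xi>\<close>. Both the expectation and the infimum are taken in
  \<^typ>\<open>ennreal\<close>, so that an infinite exponential moment violates the bound and the norm of a
  variable that admits no \<open>\<tau>\<close> is \<open>\<infinity>\<close>. There is no factor \<open>1/2\<close> in the exponent.
\<close>

definition subgaussian_norm :: "'a measure \<Rightarrow> ('a \<Rightarrow> real) \<Rightarrow> ennreal" where
  "subgaussian_norm M \<xi> =
     (INF \<tau>\<in>{\<tau>::real. 0 < \<tau> \<and>
        (\<forall>u::real. (\<integral>\<^sup>+\<omega>. ennreal (exp (u * \<xi> \<omega>)) \<partial>M) \<le> ennreal (exp (u\<^sup>2 * \<tau>\<^sup>2)))}.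
      ennreal \<tau>)"

text \<open>Only the values on \<open>[0,1]\<close> matter; there the function is continuous, as shown below.\<close>

definition Q :: "real \<Rightarrow> real" where
  "Q p =
     (if p = 0 \<or> p = 1 then 0
      else if p = 1/2 then sqrt (1/8)
      else sqrt ((1 - 2 * p) / (4 * ln ((1 - p) / p))))"

lemma continuous_on_Q: "continuous_on {0..1} Q"
proof -
  define f :: "real \<Rightarrow> real" where "f = (\<lambda>p. sqrt ((1 - 2 * p) / (4 * ln ((1 - p) / p))))"
  have Qf: "Q x = f x" if "x \<noteq> 0" "x \<noteq> 1" "x \<noteq> 1/2" for x
    using that by (simp add: Q_def f_def)
  have ev: "\<forall>\<^sub>F x in at a within {0..1}. f x = Q x" for a :: real
  proof -
    have "\<forall>\<^sub>F x in at a within {0..1}. x \<notin> {0, 1, 1/2} - {a}"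
    proof -
      have "open (- ({0, 1, 1/2} - {a}))"
        by (intro open_Compl finite_imp_closed) simp
      then have "\<forall>\<^sub>F x in nhds a. x \<in> - ({0, 1, 1/2} - {a})"
        by (rule eventually_nhds_in_open) simp
      then show ?thesis
        unfolding eventually_at_filter by eventually_elim auto
    qed
    moreover have "\<forall>\<^sub>F x in at a within {0..1}. x \<noteq> a"
      by (simp add: eventually_at_filter)
    ultimately show ?thesis
      by eventually_elim (use Qf in auto)
  qed
  have "(f \<longlongrightarrow> Q a) (at a within {0..1})" if "a \<in> {0..1}" for a
  proof -
    consider "a = 0" | "a = 1" | "a = 1/2" | "a \<noteq> 0" "a \<noteq> 1" "a \<noteq> 1/2" by blast
    then show ?thesis
    proof cases
      case 1
      have "(f \<longlongrightarrow> 0) (at_right 0)"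
        unfolding f_def by real_asymp
      with 1 show ?thesis
        by (simp add: Q_def at_within_Icc_at_right)
    next
      case 2
      have "(f \<longlongrightarrow> 0) (at_left 1)"
        unfolding f_def by real_asymp
      with 2 show ?thesis
        by (simp add: Q_def at_within_Icc_at_left)
    next
      case 3
      have "((\<lambda>p::real. (1 - 2 * p) / (4 * ln ((1 - p) / p))) \<longlongrightarrow> 1/8) (at (1/2))"
        by real_asymp
      then have "(f \<longlongrightarrow> sqrt (1/8)) (at (1/2))"
        unfolding f_def by (rule tendsto_real_sqrt)
      then have "(f \<longlongrightarrow> Q (1/2)) (at (1/2) within {0..1})"
        by (auto simp: Q_def intro: tendsto_within_subset)
      with 3 show ?thesis by blast
    next
      case 4
      then have a: "0 < a" "a < 1" using that by auto
      then have "(1 - a) / a \<noteq> 1" "(1 - a) / a > 0" using 4 by (auto simp: field_simps)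
      then have "ln ((1 - a) / a) \<noteq> 0" by simp
      then have "isCont f a"
        unfolding f_def using a \<open>(1 - a) / a > 0\<close> by (intro continuous_intros) auto
      then show ?thesis
        using 4 by (auto simp: Qf isCont_def intro: tendsto_within_subset)
    qed
  qed
  then show ?thesis
    unfolding continuous_on_def using ev by (blast intro: Lim_transform_eventually)
qed

end

theory Submission
  imports Defs
begin

text \<open>
  Let \<open>0 < p < 1\<close> and let \<open>a\<close> be half the log-odds \<open>ln ((1 - p) / p)\<close>, so that
  \<open>1 - 2 * p = tanh a\<close>. In the variable \<open>x = u / 2 - a\<close> the exponential moment of the centered
  indicator is
    \<open>exp ((x + a) * tanh a) * cosh x / cosh a\<close>,
  and \<open>8 * Q(p)\<^sup>2 = tanh a / a\<close>, which is read as \<open>1\<close> at \<open>a = 0\<close>.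

  The function \<open>tanh x / x\<close> decreases for \<open>x > 0\<close>; in other words, \<open>ln (cosh x)\<close> is concave
  as a function of \<open>x\<^sup>2\<close>. The tangent at \<open>x\<^sup>2 = a\<^sup>2\<close> therefore lies above it
  (\<open>cosh_le_tangent\<close>):
    \<open>ln (cosh x) \<le> ln (cosh a) + (x\<^sup>2 - a\<^sup>2) * (tanh a / a) / 2\<close>.
  Since \<open>(x + a) * tanh a + (x + a) * (x - a) * (tanh a / a) / 2\<close> is the square
  \<open>(x + a)\<^sup>2 * (tanh a / a) / 2 = u\<^sup>2 * Q(p)\<^sup>2\<close>, the moment is at most
  \<open>exp (u\<^sup>2 * Q(p)\<^sup>2)\<close>, so \<open>Q(p)\<close> is an admissible parameter.

  No smaller parameter is admissible. The tangent touches the curve where \<open>x\<^sup>2 = a\<^sup>2\<close>, that is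
  at \<open>x = - a\<close>, where \<open>u = 0\<close>, and at \<open>x = a\<close>, where \<open>u = 4 * a\<close>. For \<open>a \<noteq> 0\<close> the latter
  makes the bound an equality at a nonzero \<open>u\<close>. For \<open>a = 0\<close> this point
  degenerates to \<open>u = 0\<close>, and the expansion \<open>ln (cosh x) \<sim> x\<^sup>2 / 2\<close> at \<open>0\<close> replaces it.
  For \<open>p \<in> {0,1}\<close> the variable vanishes almost surely and every \<open>\<tau> > 0\<close> is admissible.
\<close>

section \<open>A quadratic bound on the hyperbolic cosine\<close>

text \<open>
  The value at \<open>0\<close> is the limit. With it \<open>tanhc a\<close> is twice the derivative of
  \<open>ln (cosh x)\<close> with respect to \<open>x\<^sup>2\<close> at every \<open>a\<close>, which lets the fair coin \<open>p = 1/2\<close>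
  share the upper bound with the other values of \<open>p\<close>.
\<close>

definition tanhc :: "real \<Rightarrow> real" where
  "tanhc a = (if a = 0 then 1 else tanh a / a)"

lemma mult_tanhc: "a * tanhc a = tanh a"
  by (simp add: tanhc_def)

lemma tanhc_abs: "tanhc \<bar>a\<bar> = tanhc a"
  by (simp add: tanhc_def abs_if)

lemma tanhc_pos: "0 < tanhc a"
  by (auto simp: tanhc_def zero_less_divide_iff)

lemma self_le_sinh:
  fixes x :: real
  assumes "0 \<le> x"
  shows "x \<le> sinh x"
proof -
  have "sinh 0 - 0 \<le> sinh x - x"
    by (rule DERIV_nonneg_imp_nondecreasing[OF assms])
      (auto intro!: exI derivative_eq_intros simp: cosh_real_ge_1)
  then show ?thesis by simp
qed

lemma self_le_sinh_mult_cosh: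
  fixes x :: real
  assumes "0 \<le> x"
  shows "x \<le> sinh x * cosh x"
proof -
  have "x * 1 \<le> sinh x * cosh x"
    using assms self_le_sinh[OF assms] by (intro mult_mono) (auto simp: cosh_real_ge_1)
  then show ?thesis by simp
qed

text \<open>
  The derivative of \<open>tanh x / x\<close> has the sign of \<open>x - sinh x * cosh x\<close>. At \<open>x = 0\<close> the claim is
  \<open>tanh y \<le> y\<close>, and it is proved separately because the quotient cannot be
  differentiated there.
\<close>

lemma tanhc_antimono:
  assumes "0 \<le> x" "x \<le> y"
  shows "tanhc y \<le> tanhc x"
proof (cases "x = 0")
  case True
  have "tanh y - y \<le> tanh 0 - 0" if "0 \<le> y"
    by (rule DERIV_nonpos_imp_nonincreasing[OF that])
      (auto intro!: exI derivative_eq_intros)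
  with True assms show ?thesis
    by (simp add: tanhc_def)
next
  case False
  with assms have "0 < x" by simp
  have "tanh y / y \<le> tanh x / x"
  proof (rule DERIV_nonpos_imp_nonincreasing[OF assms(2)])
    fix t :: real
    assume "x \<le> t"
    with \<open>0 < x\<close> have t: "0 < t" by simp
    have "((\<lambda>t. tanh t / t) has_real_derivative ((1 - (tanh t)\<^sup>2) * t - tanh t) / (t * t)) (at t)"
      using t by (auto intro!: derivative_eq_intros)
    moreover have "(1 - (tanh t)\<^sup>2) * t - tanh t \<le> 0"
    proof -
      have eq: "1 - (tanh t)\<^sup>2 = 1 / (cosh t)\<^sup>2"
        using hyperbolic_pythagoras[of t] by (simp add: tanh_def power_divide divide_simps)
      have "(1 - (tanh t)\<^sup>2) * t - tanh t = (t - sinh t * cosh t) / (cosh t)\<^sup>2"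
        unfolding eq by (simp add: tanh_def field_simps power2_eq_square)
      then show ?thesis
        using self_le_sinh_mult_cosh[of t] t by (simp add: divide_le_0_iff)
    qed
    ultimately show "\<exists>D. ((\<lambda>t. tanh t / t) has_real_derivative D) (at t) \<and> D \<le> 0"
      using t by (auto intro!: exI divide_nonpos_pos)
  qed
  with \<open>0 < x\<close> assms show ?thesis
    by (simp add: tanhc_def)
qed

text \<open>
  The gap between the tangent and \<open>ln (cosh v)\<close> has derivative
  \<open>v * (tanhc a - tanhc v)\<close>, so by monotonicity of \<open>tanhc\<close> it falls up to \<open>v = a\<close> and rises
  afterwards.
\<close>

lemma ln_cosh_le_tangent:
  fixes x a :: real
  assumes "0 \<le> x" "0 \<le> a"
  shows "ln (cosh x) \<le> ln (cosh a) + (x\<^sup>2 - a\<^sup>2) * tanhc a / 2"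
proof -
  define g where "g v = v\<^sup>2 * tanhc a / 2 - ln (cosh v)" for v
  have deriv: "(g has_real_derivative v * (tanhc a - tanhc v)) (at v)" for v
  proof -
    have "(g has_real_derivative v * tanhc a - tanh v) (at v)"
      unfolding g_def by (auto intro!: derivative_eq_intros simp: tanh_def)
    then show ?thesis
      by (simp add: right_diff_distrib mult_tanhc)
  qed
  have "g a \<le> g x"
  proof (cases "x \<le> a")
    case True
    show ?thesis
    proof (rule DERIV_nonpos_imp_nonincreasing[OF True])
      fix v assume "x \<le> v" "v \<le> a"
      with assms show "\<exists>D. (g has_real_derivative D) (at v) \<and> D \<le> 0"
        using deriv[of v] tanhc_antimono[of v a] by (auto intro!: exI mult_nonneg_nonpos)
    qed
  next
    case False
    then have "a \<le> x" by simp
    then show ?thesis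
    proof (rule DERIV_nonneg_imp_nondecreasing)
      fix v assume "a \<le> v" "v \<le> x"
      with assms show "\<exists>D. (g has_real_derivative D) (at v) \<and> 0 \<le> D"
        using deriv[of v] tanhc_antimono[of a v] by (auto intro!: exI mult_nonneg_nonneg)
    qed
  qed
  then show ?thesis
    by (simp add: g_def algebra_simps diff_divide_distrib)
qed

lemma cosh_le_tangent:
  fixes x a :: real
  shows "cosh x \<le> cosh a * exp ((x\<^sup>2 - a\<^sup>2) * tanhc a / 2)"
proof -
  have "ln (cosh x) \<le> ln (cosh a) + (x\<^sup>2 - a\<^sup>2) * tanhc a / 2"
    using ln_cosh_le_tangent[of "\<bar>x\<bar>" "\<bar>a\<bar>"] by (simp add: tanhc_abs)
  then have "exp (ln (cosh x)) \<le> exp (ln (cosh a) + (x\<^sup>2 - a\<^sup>2) * tanhc a / 2)"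
    by (simp only: exp_le_cancel_iff)
  then show ?thesis
    by (simp add: exp_add)
qed

section \<open>The exponential moments of a centered indicator\<close>

definition bernoulli_mgf :: "real \<Rightarrow> real \<Rightarrow> real" where
  "bernoulli_mgf p u = p * exp (u * (1 - p)) + (1 - p) * exp (- (u * p))"

lemma nn_integral_exp_centered_indicator:
  assumes "prob_space M" "A \<in> sets M" "measure M A = p"
  shows "(\<integral>\<^sup>+\<omega>. ennreal (exp (u * (indicator A \<omega> - p))) \<partial>M) = ennreal (bernoulli_mgf p u)"
proof -
  interpret prob_space M by fact
  have p: "0 \<le> p" "p \<le> 1" using assms(3) by auto
  have compl: "measure M (space M - A) = 1 - p"
    using prob_compl[OF assms(2)] assms(3) by simp
  have "(\<integral>\<^sup>+\<omega>. ennreal (exp (u * (indicator A \<omega> - p))) \<partial>M) =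
      (\<integral>\<^sup>+\<omega>. ennreal (exp (u * (1 - p))) * indicator A \<omega>
        + ennreal (exp (- (u * p))) * indicator (space M - A) \<omega> \<partial>M)"
    by (intro nn_integral_cong) (auto simp: indicator_def)
  also have "\<dots> = ennreal (exp (u * (1 - p))) * emeasure M A
        + ennreal (exp (- (u * p))) * emeasure M (space M - A)"
    using assms(2) by (subst nn_integral_add) (auto simp: nn_integral_cmult)
  also have "\<dots> = ennreal (bernoulli_mgf p u)"
    using p by (simp add: emeasure_eq_measure assms(3) compl bernoulli_mgf_def
        ennreal_mult[symmetric] ennreal_plus[symmetric] mult.commute del: ennreal_plus)
  finally show ?thesis .
qed

locale half_log_odds =
  fixes p a :: real
  assumes p_eq: "p = 1 / (1 + exp (2 * a))"
begin

lemma p_eq_cosh: "p = exp (- a) / (2 * cosh a)"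
proof -
  have "1 + exp (2 * a) = exp a * (2 * cosh a)"
    by (simp add: cosh_def ring_distribs flip: exp_add)
  then show ?thesis
    by (simp add: p_eq exp_minus field_simps)
qed

lemma one_minus_p_eq_cosh: "1 - p = exp a / (2 * cosh a)"
proof -
  have "2 * cosh a - exp (- a) = exp a"
    by (simp add: cosh_field_def add_divide_distrib)
  moreover have "1 - p = (2 * cosh a - exp (- a)) / (2 * cosh a)"
    by (simp add: p_eq_cosh diff_divide_distrib)
  ultimately show ?thesis
    by simp
qed

lemma one_minus_2p_eq_tanh: "1 - 2 * p = tanh a"
proof -
  have "1 - 2 * p = (1 - p) - p" by simp
  also have "\<dots> = exp a / (2 * cosh a) - exp (- a) / (2 * cosh a)"
    by (simp only: one_minus_p_eq_cosh) (simp only: p_eq_cosh)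
  also have "\<dots> = tanh a"
    by (simp add: tanh_def sinh_def flip: diff_divide_distrib)
  finally show ?thesis .
qed

lemma Q_eq: "Q p = sqrt (tanhc a / 8)"
proof -
  have bounds: "p \<noteq> 0" "p \<noteq> 1"
    using p_eq_cosh one_minus_p_eq_cosh by auto
  have "(1 - p) / p = exp a * exp a"
    by (simp only: one_minus_p_eq_cosh) (simp add: p_eq_cosh exp_minus field_simps)
  then have ratio: "(1 - p) / p = exp (2 * a)"
    by (simp flip: exp_add)
  have "p = 1 / 2 \<longleftrightarrow> tanh a = 0"
    by (simp add: field_simps flip: one_minus_2p_eq_tanh)
  then have half: "p = 1 / 2 \<longleftrightarrow> a = 0"
    by simp
  show ?thesis
  proof (cases "a = 0")
    case True
    then show ?thesis using half by (simp add: Q_def tanhc_def)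
  next
    case False
    then show ?thesis
      using bounds half by (simp add: Q_def ratio one_minus_2p_eq_tanh tanhc_def)
  qed
qed

text \<open>
  Taking the factor \<open>exp (u * (1/2 - p))\<close> out of the moment leaves exponentials of
  \<open>u / 2\<close> and \<open>- u / 2\<close>, whose weights \<open>p\<close> and \<open>1 - p\<close> are proportional to \<open>exp (- a)\<close> and \<open>exp a\<close>;
  hence the weighted sum is a shifted hyperbolic cosine.
\<close>

lemma bernoulli_mgf_eq:
  "bernoulli_mgf p u = exp (u / 2 * tanh a) * cosh (u / 2 - a) / cosh a"
proof -
  have "exp (u / 2 * tanh a) * exp (u / 2) = exp (u * (1 - p))"
    unfolding exp_add[symmetric] one_minus_2p_eq_tanh[symmetric] by (simp add: algebra_simps)
  moreover have "exp (u / 2 * tanh a) * exp (- (u / 2)) = exp (- (u * p))"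
    unfolding exp_add[symmetric] one_minus_2p_eq_tanh[symmetric] by (simp add: algebra_simps)
  moreover have "cosh (u / 2 - a) / cosh a = p * exp (u / 2) + (1 - p) * exp (- (u / 2))"
    unfolding one_minus_p_eq_cosh
    by (simp only: p_eq_cosh cosh_def[of "u / 2 - a"])
      (simp add: field_simps flip: exp_add exp_minus)
  ultimately show ?thesis
    by (simp add: bernoulli_mgf_def ring_distribs mult.left_commute flip: times_divide_eq_right)
qed

lemma bernoulli_mgf_le: "bernoulli_mgf p u \<le> exp (u\<^sup>2 * (Q p)\<^sup>2)"
proof -
  let ?x = "u / 2 - a"
  have "bernoulli_mgf p u
      \<le> exp (u / 2 * tanh a) * (cosh a * exp ((?x\<^sup>2 - a\<^sup>2) * tanhc a / 2)) / cosh a"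
    unfolding bernoulli_mgf_eq
    by (intro divide_right_mono mult_left_mono cosh_le_tangent) auto
  also have "\<dots> = exp (u / 2 * tanh a + (?x\<^sup>2 - a\<^sup>2) * tanhc a / 2)"
    by (simp add: exp_add)
  also have "u / 2 * tanh a + (?x\<^sup>2 - a\<^sup>2) * tanhc a / 2 = u\<^sup>2 * (tanhc a / 8)"
    unfolding mult_tanhc[symmetric] by (simp add: field_simps power2_eq_square)
  also have "tanhc a / 8 = (Q p)\<^sup>2"
    using tanhc_pos[of a] by (simp add: Q_eq)
  finally show ?thesis .
qed

text \<open>
  At \<open>u = 4 * a\<close> the shifted argument \<open>u / 2 - a\<close> equals \<open>a\<close>, so the two hyperbolic
  cosines cancel and \<open>\<tau>\<close> is compared with \<open>Q p\<close> directly. If \<open>a = 0\<close>, this gives nothing, and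
  the comparison is made in the limit \<open>u \<rightarrow> 0\<close>.
\<close>

lemma Q_le_of_bernoulli_mgf_le:
  assumes "0 < \<tau>" and le: "\<And>u. bernoulli_mgf p u \<le> exp (u\<^sup>2 * \<tau>\<^sup>2)"
  shows "Q p \<le> \<tau>"
proof -
  have "tanhc a / 8 \<le> \<tau>\<^sup>2"
  proof (cases "a = 0")
    case True
    have "ln (cosh x) / x\<^sup>2 \<le> 4 * \<tau>\<^sup>2" if "0 < x" for x :: real
    proof -
      have "cosh x \<le> exp (4 * x\<^sup>2 * \<tau>\<^sup>2)"
        using le[of "2 * x"] True by (simp add: bernoulli_mgf_eq power_mult_distrib)
      then have "ln (cosh x) \<le> ln (exp (4 * x\<^sup>2 * \<tau>\<^sup>2))"
        by (subst ln_le_cancel_iff) auto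
      with that show ?thesis
        by (simp add: field_simps)
    qed
    then have "\<forall>\<^sub>F x in at_right 0. ln (cosh x) / x\<^sup>2 \<le> 4 * \<tau>\<^sup>2"
      by (auto simp: eventually_at_filter)
    moreover have "((\<lambda>x::real. ln (cosh x) / x\<^sup>2) \<longlongrightarrow> 1 / 2) (at_right 0)"
      unfolding cosh_field_def by real_asymp
    ultimately have "1 / 2 \<le> 4 * \<tau>\<^sup>2"
      by (intro tendsto_upperbound) auto
    with True show ?thesis by (simp add: tanhc_def)
  next
    case False
    have "exp ((4 * a)\<^sup>2 * (tanhc a / 8)) = bernoulli_mgf p (4 * a)"
      unfolding bernoulli_mgf_eq mult_tanhc[symmetric] by (simp add: power2_eq_square)
    also have "\<dots> \<le> exp ((4 * a)\<^sup>2 * \<tau>\<^sup>2)"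
      by (rule le)
    finally show ?thesis
      using False by simp
  qed
  then show ?thesis
    using assms(1) by (simp add: Q_eq real_le_lsqrt)
qed

end

lemma half_log_odds_exists:
  assumes "0 < p" "p < 1"
  shows "half_log_odds p (ln ((1 - p) / p) / 2)"
proof
  show "p = 1 / (1 + exp (2 * (ln ((1 - p) / p) / 2)))"
    using assms by (simp add: field_simps)
qed

section \<open>The subgaussian norm\<close>

lemma subgaussian_norm_eqI:
  assumes "0 < c"
    and "\<And>u. (\<integral>\<^sup>+\<omega>. ennreal (exp (u * \<xi> \<omega>)) \<partial>M) \<le> ennreal (exp (u\<^sup>2 * c\<^sup>2))"
    and "\<And>\<tau>. 0 < \<tau> \<Longrightarrow>
      (\<And>u. (\<integral>\<^sup>+\<omega>. ennreal (exp (u * \<xi> \<omega>)) \<partial>M) \<le> ennreal (exp (u\<^sup>2 * \<tau>\<^sup>2))) \<Longrightarrow> c \<le> \<tau>"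
  shows "subgaussian_norm M \<xi> = ennreal c"
  unfolding subgaussian_norm_def
  using assms by (intro antisym INF_lower INF_greatest) (auto intro!: ennreal_leI)

lemma subgaussian_norm_eq_0:
  assumes "\<And>u. (\<integral>\<^sup>+\<omega>. ennreal (exp (u * \<xi> \<omega>)) \<partial>M) \<le> 1"
  shows "subgaussian_norm M \<xi> = 0"
proof -
  have "subgaussian_norm M \<xi> \<le> ennreal \<epsilon>" if "0 < \<epsilon>" for \<epsilon>
    unfolding subgaussian_norm_def
    using that by (intro INF_lower) (auto intro!: order_trans[OF assms] simp: ennreal_ge_1)
  then show ?thesis
    using ennreal_le_epsilon[of 0 "subgaussian_norm M \<xi>"] by simp
qed

theorem theorem2p1:
  fixes M :: "'a measure" and A :: "'a set" and p :: real
  assumes "prob_space M"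
    and "p \<in> {0..1}"
    and "A \<in> sets M"
    and "measure M A = p"
  shows "subgaussian_norm M (\<lambda>\<omega>. indicator A \<omega> - p) = ennreal (Q p)"
proof -
  note mgf = nn_integral_exp_centered_indicator[OF assms(1,3,4)]
  show ?thesis
  proof (cases "p = 0 \<or> p = 1")
    case True
    then have "bernoulli_mgf p u = 1" for u
      by (auto simp: bernoulli_mgf_def)
    then have "subgaussian_norm M (\<lambda>\<omega>. indicator A \<omega> - p) = 0"
      by (intro subgaussian_norm_eq_0) (simp add: mgf)
    with True show ?thesis
      by (auto simp: Q_def)
  next
    case False
    with assms(2) have p: "0 < p" "p < 1" by auto
    interpret half_log_odds p "ln ((1 - p) / p) / 2"
      by (rule half_log_odds_exists[OF p])
    show ?thesis
    proof (rule subgaussian_norm_eqI)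
      show "0 < Q p"
        by (simp add: Q_eq tanhc_pos)
      show "(\<integral>\<^sup>+\<omega>. ennreal (exp (u * (indicator A \<omega> - p))) \<partial>M) \<le> ennreal (exp (u\<^sup>2 * (Q p)\<^sup>2))" for u
        unfolding mgf by (intro ennreal_leI bernoulli_mgf_le)
      show "Q p \<le> \<tau>" if "0 < \<tau>"
        and "\<And>u. (\<integral>\<^sup>+\<omega>. ennreal (exp (u * (indicator A \<omega> - p))) \<partial>M) \<le> ennreal (exp (u\<^sup>2 * \<tau>\<^sup>2))" for \<tau>
        using that unfolding mgf by (intro Q_le_of_bernoulli_mgf_le) auto
    qed
  qed
qed

end
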